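(* Let $\mathcal{G}$ be a finite simple graph of order $p=|V(\mathcal{G})|$ with $|e(\mathcal{G})|$ edges and first Zagreb index $M_1(\mathcal{G})$, with vertices labelled $v_1,\dots,v_p$ so that $\mathrm{CNRS}(\mathcal{G})_{1,1}\ge\cdots\ge\mathrm{CNRS}(\mathcal{G})_{p,p}$, where $\mathrm{CNRS}(\mathcal{G})_{i,i}=d(v_i)(m(v_i)-1)$. Then both $LE_{CN}(\mathcal{G})$ and $LE^+_{CN}(\mathcal{G})$ are at most \[ \sum_{i=1}^{p}\sqrt{\left(\mathrm{CNRS}(\mathcal{G})_{i,i}-\frac{M_1(\mathcal{G})-2|e(\mathcal{G})|}{p}\right)^2+\sum_{k=1,\,k\neq i}^{p}|N(v_i)\cap N(v_k)|^2}. \]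
   Context: $N(v)$ is the open neighbourhood of $v$, $d(v)=|N(v)|$, and $m(v)$ is the average degree of the neighbours of $v$ ($m(v)=0$ if $v$ is isolated). $M_1(\mathcal{G})=\sum_i d(v_i)^2$. $\mathrm{CN}(\mathcal{G})$ has $(i,j)$-entry $|N(v_i)\cap N(v_j)|$ for $i\neq j$ and $0$ on the diagonal; $\mathrm{CNRS}(\mathcal{G})$ is the diagonal matrix of its row sums; $\mathrm{CNL}=\mathrm{CNRS}-\mathrm{CN}$, $\mathrm{CNSL}=\mathrm{CNRS}+\mathrm{CN}$; $LE_{CN}(\mathcal{G})=\sum_\nu|\nu-tr(\mathrm{CNRS}(\mathcal{G}))/p|$ over eigenvalues of $\mathrm{CNL}(\mathcal{G})$ with multiplicity, and $LE^+_{CN}(\mathcal{G})$ likewise with $\mathrm{CNSL}(\mathcal{G})$. *)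

theory Defs
  imports
    Complex_Main
    "Graph_Theory.Pair_Digraph"
    "Jordan_Normal_Form.Char_Poly"
    "Jordan_Normal_Form.Spectral_Radius"
begin

text \<open>
  A finite simple graph is a \<^locale>\<open>pair_graph\<close>: a finite, loop-free, symmetric set of ordered
  pairs, in which an undirected edge between \<open>u\<close> and \<open>w\<close> is represented by the two arcs
  \<open>(u, w)\<close> and \<open>(w, u)\<close>.
\<close>

definition order_of :: "'a pair_pre_digraph \<Rightarrow> nat" where
  "order_of G = card (pverts G)"

text \<open>The two arcs of an undirected edge are identified here, so \<open>card (edges G)\<close> counts
  each edge once.\<close>

definition edges :: "'a pair_pre_digraph \<Rightarrow> 'a set set" where
  "edges G = {{u, w} | u w. (u, w) \<in> parcs G}"

definition nbhd :: "'a pair_pre_digraph \<Rightarrow> 'a \<Rightarrow> 'a set" where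
  "nbhd G x = {y. (x, y) \<in> parcs G}"

definition deg :: "'a pair_pre_digraph \<Rightarrow> 'a \<Rightarrow> nat" where
  "deg G x = card (nbhd G x)"

definition avg_nbr_deg :: "'a pair_pre_digraph \<Rightarrow> 'a \<Rightarrow> real" where
  "avg_nbr_deg G x =
     (if nbhd G x = {} then 0 else (\<Sum>y\<in>nbhd G x. real (deg G y)) / real (deg G x))"

definition zagreb1 :: "'a pair_pre_digraph \<Rightarrow> nat" where
  "zagreb1 G = (\<Sum>x\<in>pverts G. (deg G x)\<^sup>2)"

text \<open>A labelling enumerates the vertices as \<open>v 0, \<dots>, v (p - 1)\<close>; matrix indices start at 0.\<close>

definition labelling :: "'a pair_pre_digraph \<Rightarrow> (nat \<Rightarrow> 'a) \<Rightarrow> bool" where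
  "labelling G v \<longleftrightarrow> bij_betw v {..<order_of G} (pverts G)"

definition CN :: "'a pair_pre_digraph \<Rightarrow> (nat \<Rightarrow> 'a) \<Rightarrow> real mat" where
  "CN G v = mat (order_of G) (order_of G)
     (\<lambda>(i, j). if i = j then 0 else real (card (nbhd G (v i) \<inter> nbhd G (v j))))"

definition CNRS :: "'a pair_pre_digraph \<Rightarrow> (nat \<Rightarrow> 'a) \<Rightarrow> real mat" where
  "CNRS G v = mat_diag (order_of G) (\<lambda>i. \<Sum>j<order_of G. CN G v $$ (i, j))"

definition CNL :: "'a pair_pre_digraph \<Rightarrow> (nat \<Rightarrow> 'a) \<Rightarrow> real mat" where
  "CNL G v = CNRS G v - CN G v"

definition CNSL :: "'a pair_pre_digraph \<Rightarrow> (nat \<Rightarrow> 'a) \<Rightarrow> real mat" where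
  "CNSL G v = CNRS G v + CN G v"

definition tr :: "real mat \<Rightarrow> real" where
  "tr A = (\<Sum>i<dim_row A. A $$ (i, i))"

text \<open>
  The sum of \<open>\<bar>\<nu> - c\<bar>\<close> over the eigenvalues \<open>\<nu>\<close> of \<open>A\<close>, each counted with its multiplicity as a
  root of the characteristic polynomial. Only real eigenvalues are seen; the matrices it is
  applied to below are real symmetric, so they have no others.
\<close>

definition spectral_deviation :: "real mat \<Rightarrow> real \<Rightarrow> real" where
  "spectral_deviation A c =
     (\<Sum>\<nu>\<in>spectrum A. real (Polynomial.order \<nu> (char_poly A)) * \<bar>\<nu> - c\<bar>)"

text \<open>Relabelling conjugates the matrices by a permutation matrix, so the two energies do not
  depend on the labelling through which they are computed.\<close>

definition LE_CN :: "'a pair_pre_digraph \<Rightarrow> (nat \<Rightarrow> 'a) \<Rightarrow> real" where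
  "LE_CN G v = spectral_deviation (CNL G v) (tr (CNRS G v) / real (order_of G))"

definition LE_CN_plus :: "'a pair_pre_digraph \<Rightarrow> (nat \<Rightarrow> 'a) \<Rightarrow> real" where
  "LE_CN_plus G v = spectral_deviation (CNSL G v) (tr (CNRS G v) / real (order_of G))"

end

theory Submission
  imports Defs "HOL-Analysis.L2_Norm"
begin

text \<open>
  A unitary Schur triangularisation \<open>U\<^sup>* A U\<close> has the eigenvalues of \<open>A\<close> on its diagonal, so for
  \<open>M = A - c I\<close> each \<open>\<nu>\<^sub>i - c\<close> equals \<open>(U\<^sup>* M U)\<^sub>i\<^sub>i = \<Sum>\<^sub>k cnj U\<^sub>k\<^sub>i (M U)\<^sub>k\<^sub>i\<close>. Taking absolute
  values, summing over \<open>i\<close> first and applying Cauchy-Schwarz for each \<open>k\<close> bounds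
  \<open>\<Sum>\<^sub>i \<bar>\<nu>\<^sub>i - c\<bar>\<close> by the sum of the Euclidean norms of the rows of \<open>M\<close>, because row \<open>k\<close> of \<open>U\<close>
  is a unit vector and rows \<open>k\<close> of \<open>M U\<close> and \<open>M\<close> have the same norm. Both Laplacians have, up to
  sign, the same off-diagonal entries, and counting walks of length two gives the diagonal and
  the trace of \<open>CNRS\<close>.
\<close>

section \<open>Unitary Schur triangularisation\<close>

abbreviation mat_ctranspose :: "complex mat \<Rightarrow> complex mat" where
  "mat_ctranspose A \<equiv> transpose_mat (map_mat cnj A)"

lemma mult_mat_index_sum:
  assumes "A \<in> carrier_mat m n" "B \<in> carrier_mat n k" "i < m" "j < k"
  shows "(A * B) $$ (i, j) = (\<Sum>l<n. A $$ (i, l) * B $$ (l, j))"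
  using assms by (simp add: scalar_prod_def atLeast0LessThan)

lemma cscalar_prod_self: "w \<bullet>c w = complex_of_real (\<Sum>i<dim_vec w. (cmod (w $ i))\<^sup>2)"
  by (simp add: scalar_prod_def conjugate_complex_def complex_norm_square atLeast0LessThan
      flip: of_real_power)

text \<open>Gram-Schmidt on a basis starting with \<open>v\<close> leaves \<open>v\<close> in front,
  and normalising the resulting vectors gives the columns of \<open>W\<close>. The factor
  \<open>c\<close> may stay unspecified because every multiple of an eigenvector satisfies the same
  eigenvector equation.\<close>

lemma orthonormal_completion:
  fixes v :: "complex vec"
  assumes v: "v \<in> carrier_vec n" and v0: "v \<noteq> 0\<^sub>v n"
  obtains W c where "W \<in> carrier_mat n n" "mat_ctranspose W * W = 1\<^sub>m n" "col W 0 = c \<cdot>\<^sub>v v"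
proof -
  interpret cof_vec_space n "TYPE(complex)" .
  define b where "b = basis_completion v"
  define ws where "ws = gram_schmidt n b"
  from basis_completion[OF v v0, folded b_def]
  have dist_b: "distinct b" and indep: "\<not> lin_dep (set b)" and b: "set b \<subseteq> carrier_vec n"
    and hdb: "hd b = v" and len_b: "length b = n" by auto
  from v v0 have n: "n > 0" by (cases n) auto
  with hdb len_b obtain vs where bv: "b = v # vs" by (cases b, auto)
  from gram_schmidt_result[OF b dist_b indep refl, folded ws_def]
  have ws: "set ws \<subseteq> carrier_vec n" and orth: "corthogonal ws" and len: "length ws = n"
    by (auto simp: len_b)
  have "hd ws = v"
    using gram_schmidt_hd[OF v, of vs, folded bv] unfolding ws_def .
  with len n have ws0: "ws ! 0 = v"
    by (cases ws) auto
  \<comment> \<open>The reciprocal of the Euclidean norm of \<open>w\<close>.\<close>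
  define c where "c w = complex_of_real (1 / sqrt (\<Sum>i<n. (cmod (w $ i))\<^sup>2))" for w :: "complex vec"
  define W where "W = mat_of_cols n (map (\<lambda>w. c w \<cdot>\<^sub>v w) ws)"
  have W: "W \<in> carrier_mat n n"
    using mat_of_cols_carrier(1)[of n "map (\<lambda>w. c w \<cdot>\<^sub>v w) ws"] len
    unfolding W_def by (simp only: length_map)
  have wsn: "ws ! i \<in> carrier_vec n" if "i < n" for i
    using ws len that by auto
  have Wij: "W $$ (k, i) = c (ws ! i) * ws ! i $ k" if "k < n" "i < n" for k i
    using that wsn[of i] len by (simp add: W_def mat_of_cols_index)
  have "mat_ctranspose W * W = 1\<^sub>m n"
  proof (rule eq_matI)
    fix i j assume "i < dim_row (1\<^sub>m n)" "j < dim_col (1\<^sub>m n)"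
    then have ij: "i < n" "j < n" by simp_all
    then have "(mat_ctranspose W * W) $$ (i, j) = (\<Sum>k<n. cnj (W $$ (k, i)) * W $$ (k, j))"
      using W by (simp add: scalar_prod_def atLeast0LessThan)
    also have "\<dots> = cnj (c (ws ! i)) * c (ws ! j) * (ws ! j \<bullet>c ws ! i)"
      using ij wsn[OF ij(1)]
      by (simp add: Wij scalar_prod_def conjugate_complex_def atLeast0LessThan sum_distrib_left mult_ac)
    also have "\<dots> = (if i = j then 1 else 0)"
    proof (cases "i = j")
      case True
      define r where "r = (\<Sum>k<n. (cmod (ws ! i $ k))\<^sup>2)"
      have wr: "ws ! i \<bullet>c ws ! i = complex_of_real r"
        using cscalar_prod_self[of "ws ! i"] wsn[OF ij(1)] by (simp add: r_def)
      moreover have "ws ! i \<bullet>c ws ! i \<noteq> 0"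
        using corthogonalD[OF orth, of i i] ij len by simp
      moreover have "r \<ge> 0" by (simp add: r_def sum_nonneg)
      ultimately have r: "r > 0" by (simp add: less_le)
      have "c (ws ! i) = complex_of_real (1 / sqrt r)"
        by (simp only: c_def r_def)
      then have "cnj (c (ws ! i)) * c (ws ! i) = complex_of_real (1 / sqrt r * (1 / sqrt r))"
        by (simp only: complex_cnj_complex_of_real of_real_mult)
      also have "1 / sqrt r * (1 / sqrt r) = 1 / r"
        using r by simp
      finally show ?thesis using True wr r by simp
    next
      case False
      then show ?thesis using corthogonalD[OF orth, of j i] ij len by simp
    qed
    finally show "(mat_ctranspose W * W) $$ (i, j) = 1\<^sub>m n $$ (i, j)"
      using ij by simp
  qed (use W in auto)
  moreover have "col W 0 = c v \<cdot>\<^sub>v v"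
    using n len ws0 v by (simp add: W_def)
  ultimately show ?thesis using that W by blast
qed

lemma mat_ctranspose_mult:
  assumes "A \<in> carrier_mat m n" "B \<in> carrier_mat n k"
  shows "mat_ctranspose (A * B) = mat_ctranspose B * mat_ctranspose A"
  using assms by (intro eq_matI) (auto simp: scalar_prod_def mult.commute)

text \<open>Deflation by induction on \<open>es\<close>: a unitary matrix whose first column is an
  eigenvector for \<open>e\<close> makes \<open>A\<close> block triangular with corner
  \<open>e\<close>, and the remaining block has the remaining factors as its characteristic
  polynomial. Only the diagonal is recorded, since it alone carries the eigenvalues.\<close>

lemma unitary_schur_diagonal:
  fixes A :: "complex mat"
  assumes "A \<in> carrier_mat n n" "char_poly A = (\<Prod>e\<leftarrow>es. [:- e, 1:])"
  shows "\<exists>U \<in> carrier_mat n n. mat_ctranspose U * U = 1\<^sub>m n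
    \<and> diag_mat (mat_ctranspose U * A * U) = es"
  using assms
proof (induction es arbitrary: n A)
  case Nil
  \<comment> \<open>The empty product has degree 0, while the characteristic polynomial has degree
    \<open>n\<close>.\<close>
  then have "n = 0" using degree_monic_char_poly[of A n] by simp
  with Nil show ?case by (intro bexI[of _ "1\<^sub>m 0"]) (auto simp: diag_mat_def)
next
  case (Cons e es)
  note A = Cons.prems(1)
  have ev: "eigenvalue A e"
    unfolding eigenvalue_root_char_poly[OF A] Cons.prems(2) by simp
  then obtain v where v: "v \<in> carrier_vec n" "v \<noteq> 0\<^sub>v n" and Av: "A *\<^sub>v v = e \<cdot>\<^sub>v v"
    using A unfolding eigenvalue_def eigenvector_def by auto
  obtain m where n: "n = Suc m" using v by (cases n) auto
  obtain W c where W: "W \<in> carrier_mat n n" and WW: "mat_ctranspose W * W = 1\<^sub>m n"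
    and W0: "col W 0 = c \<cdot>\<^sub>v v"
    using orthonormal_completion[OF v] by blast
  let ?W' = "mat_ctranspose W"
  have W': "?W' \<in> carrier_mat n n" using W by auto
  have WW': "W * ?W' = 1\<^sub>m n"
    by (rule mat_mult_left_right_inverse[OF W' W WW])
  define A' where "A' = ?W' * A * W"
  have A': "A' \<in> carrier_mat n n" unfolding A'_def using W W' A by auto
  have sim: "similar_mat A' A"
    unfolding similar_mat_def
    by (intro exI, rule similar_mat_witI[OF WW WW' A'_def A' A W' W])
  \<comment> \<open>Column 0 of \<open>W\<close> is an eigenvector, so column 0 of \<open>A'\<close>
    is \<open>e\<close> times column 0 of \<open>?W' * W\<close>, that is, of the identity.\<close>
  have "A' = ?W' * (A * W)"
    unfolding A'_def by (rule assoc_mult_mat[OF W' A W])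
  then have "col A' 0 = ?W' *\<^sub>v col (A * W) 0"
    using col_mult2[OF W' mult_carrier_mat[OF A W], of 0] n by (simp only: zero_less_Suc)
  also have "col (A * W) 0 = A *\<^sub>v col W 0"
    using col_mult2[OF A W, of 0] n by (simp only: zero_less_Suc)
  also have "A *\<^sub>v col W 0 = e \<cdot>\<^sub>v col W 0"
    using W0 Av v A by (simp add: mult_mat_vec smult_smult_assoc mult.commute)
  also have "?W' *\<^sub>v (e \<cdot>\<^sub>v col W 0) = e \<cdot>\<^sub>v (?W' *\<^sub>v col W 0)"
    by (rule mult_mat_vec[OF W']) (simp add: W0 v)
  also have "?W' *\<^sub>v col W 0 = col (?W' * W) 0"
    using col_mult2[OF W' W, of 0] n by (simp only: zero_less_Suc)
  finally have col0: "col A' 0 = e \<cdot>\<^sub>v unit_vec n 0"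
    using n WW by simp
  have A'i0: "A' $$ (i, 0) = (if i = 0 then e else 0)" if "i < n" for i
    using arg_cong[OF col0, of "\<lambda>x. x $ i"] that A' n by auto
  define A2 where "A2 = mat 1 m (\<lambda>(i, j). A' $$ (i, Suc j))"
  define A3 where "A3 = mat m m (\<lambda>(i, j). A' $$ (Suc i, Suc j))"
  define A1 where "A1 = mat 1 1 (\<lambda>_. e)"
  have A1: "A1 \<in> carrier_mat 1 1" and A2: "A2 \<in> carrier_mat 1 m" and A3: "A3 \<in> carrier_mat m m"
    by (auto simp: A1_def A2_def A3_def)
  have A'block: "A' = four_block_mat A1 A2 (0\<^sub>m m 1) A3"
    using A' n A'i0 by (intro eq_matI) (auto simp: A1_def A2_def A3_def less_Suc_eq_0_disj)
  \<comment> \<open>Similarity preserves the characteristic polynomial and the block form factors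
    it; cancelling the linear factor of \<open>e\<close> leaves that of \<open>A3\<close>.\<close>
  have "[:- e, 1:] * (\<Prod>e\<leftarrow>es. [:- e, 1:]) = char_poly A1 * char_poly A3"
    using char_poly_similar[OF sim] Cons.prems(2)
      char_poly_four_block_zeros_col[OF A1 A2 A3] A'block by simp
  moreover have "char_poly A1 = [:- e, 1:]"
    by (simp add: A1_def char_poly_defs det_def sign_def)
  ultimately have "char_poly A3 = (\<Prod>e\<leftarrow>es. [:- e, 1:])"
    by (metis mult_cancel_left pCons_eq_0_iff zero_neq_one)
  from Cons.IH[OF A3 this] obtain P where P: "P \<in> carrier_mat m m"
    and PP: "mat_ctranspose P * P = 1\<^sub>m m" and diagP: "diag_mat (mat_ctranspose P * A3 * P) = es"
    by blast
  let ?P' = "mat_ctranspose P"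
  \<comment> \<open>The unitary \<open>P\<close> for the smaller block, extended by a 1 in the
    corner, keeps \<open>e\<close> in place; \<open>W * Q\<close> is then the matrix sought for
    \<open>A\<close>.\<close>
  define Q where "Q = four_block_mat (1\<^sub>m 1) (0\<^sub>m 1 m) (0\<^sub>m m 1) P"
  have Q: "Q \<in> carrier_mat n n" using P n unfolding Q_def by auto
  have P': "?P' \<in> carrier_mat m m" using P by auto
  have Q': "mat_ctranspose Q = four_block_mat (1\<^sub>m 1) (0\<^sub>m 1 m) (0\<^sub>m m 1) ?P'"
    using P by (intro eq_matI) (auto simp: Q_def)
  have QQ: "mat_ctranspose Q * Q = 1\<^sub>m n"
    unfolding Q' using P P' PP n
    by (simp add: Q_def mult_four_block_mat[of _ 1 1 _ m _ m _ _ 1 _ m])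
  have QAQ: "mat_ctranspose Q * A' * Q = four_block_mat A1 (A2 * P) (0\<^sub>m m 1) (?P' * A3 * P)"
    unfolding Q' A'block unfolding Q_def using P P' A1 A2 A3
    by (simp add: mult_four_block_mat[of _ 1 1 _ m _ m _ _ 1 _ m])
  let ?U = "W * Q"
  have U: "?U \<in> carrier_mat n n" using W Q by auto
  have Qc: "mat_ctranspose Q \<in> carrier_mat n n" using Q by auto
  have adjU: "mat_ctranspose ?U = mat_ctranspose Q * ?W'"
    by (rule mat_ctranspose_mult[OF W Q])
  have "mat_ctranspose ?U * ?U = mat_ctranspose Q * (?W' * W) * Q"
    unfolding adjU using W W' Q Qc by (simp add: assoc_mult_mat[of _ n n _ n _ n])
  then have UU: "mat_ctranspose ?U * ?U = 1\<^sub>m n"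
    using WW Q Qc QQ by simp
  have "mat_ctranspose ?U * A * ?U = mat_ctranspose Q * A' * Q"
    unfolding adjU A'_def using W W' Q Qc A by (simp add: assoc_mult_mat[of _ n n _ n _ n])
  then have "diag_mat (mat_ctranspose ?U * A * ?U) = diag_mat A1 @ diag_mat (?P' * A3 * P)"
    unfolding QAQ using diag_four_block_mat[OF A1, of "?P' * A3 * P" m] P P' A3 by simp
  also have "\<dots> = e # es"
    using diagP by (simp add: A1_def diag_mat_def)
  finally show ?case using U UU by blast
qed

section \<open>Eigenvalue deviations against row norms\<close>

lemma sum_eigenvalues_le_sum_row_norms:
  fixes A :: "complex mat"
  assumes A: "A \<in> carrier_mat n n" and cp: "char_poly A = (\<Prod>e\<leftarrow>es. [:- e, 1:])"
  shows "(\<Sum>e\<leftarrow>es. cmod (e - c))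
    \<le> (\<Sum>k<n. L2_set (\<lambda>j. cmod (A $$ (k, j) - (if k = j then c else 0))) {..<n})"
proof -
  obtain U where U: "U \<in> carrier_mat n n" and UU: "mat_ctranspose U * U = 1\<^sub>m n"
    and diag: "diag_mat (mat_ctranspose U * A * U) = es"
    using unitary_schur_diagonal[OF A cp] by blast
  let ?V = "mat_ctranspose U"
  have V: "?V \<in> carrier_mat n n" using U by auto
  \<comment> \<open>Orthonormal columns of a square matrix force orthonormal rows, which is the form
    used in \<open>U_row\<close> and \<open>MU_row\<close>.\<close>
  have UV: "U * ?V = 1\<^sub>m n" by (rule mat_mult_left_right_inverse[OF V U UU])
  define M where "M = A - c \<cdot>\<^sub>m 1\<^sub>m n"
  have M: "M \<in> carrier_mat n n" using A unfolding M_def by auto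
  let ?MU = "M * U"
  have MU: "?MU \<in> carrier_mat n n" using M U by auto
  have VMU: "?V * ?MU = ?V * A * U - c \<cdot>\<^sub>m 1\<^sub>m n"
  proof -
    have "?MU = A * U - c \<cdot>\<^sub>m U"
      unfolding M_def using A U
      by (simp add: minus_mult_distrib_mat[of _ n n _ _ n] mult_smult_assoc_mat[of _ n n _ n])
    then have "?V * ?MU = ?V * (A * U) - c \<cdot>\<^sub>m (?V * U)"
      using A U V
      by (simp add: mult_minus_distrib_mat[of _ n n _ n] mult_smult_distrib[of _ n n _ n])
    then show ?thesis using UU A U V by (simp add: assoc_mult_mat[of _ n n _ n _ n])
  qed
  have len: "length es = n" using diag U by (auto simp: diag_mat_def)
  have shifted: "es ! i - c = (\<Sum>k<n. cnj (U $$ (k, i)) * ?MU $$ (k, i))" if "i < n" for i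
  proof -
    have "es ! i = (?V * A * U) $$ (i, i)"
      using diag that U by (auto simp: diag_mat_def)
    then have "es ! i - c = (?V * ?MU) $$ (i, i)"
      unfolding VMU using that U A V by simp
    also have "\<dots> = (\<Sum>k<n. cnj (U $$ (k, i)) * ?MU $$ (k, i))"
      unfolding mult_mat_index_sum[OF V MU that that] using that U by (intro sum.cong) auto
    finally show ?thesis .
  qed
  \<comment> \<open>Squared row norms are the diagonal entries of
    \<open>B * mat_ctranspose B\<close>, a product unchanged when \<open>B\<close> is multiplied on
    the right by a unitary matrix.\<close>
  have row_norm: "(\<Sum>i<n. (cmod (B $$ (k, i)))\<^sup>2) = Re ((B * mat_ctranspose B) $$ (k, k))"
    if "B \<in> carrier_mat n n" "k < n" for B k
    using that by (simp add: scalar_prod_def atLeast0LessThan complex_mult_cnj cmod_power2)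
  have U_row: "L2_set (\<lambda>i. cmod (U $$ (k, i))) {..<n} = 1" if "k < n" for k
    unfolding L2_set_def using row_norm[OF U that] UV that by simp
  have "?MU * mat_ctranspose ?MU = M * (U * ?V) * mat_ctranspose M"
    using M U V by (simp add: mat_ctranspose_mult[of _ n n _ n] assoc_mult_mat[of _ n n _ n _ n])
  then have "?MU * mat_ctranspose ?MU = M * mat_ctranspose M"
    using UV M by simp
  then have MU_row: "L2_set (\<lambda>i. cmod (?MU $$ (k, i))) {..<n} = L2_set (\<lambda>j. cmod (M $$ (k, j))) {..<n}"
    if "k < n" for k
    unfolding L2_set_def using row_norm[OF MU that] row_norm[OF M that] by simp
  have "(\<Sum>e\<leftarrow>es. cmod (e - c)) = (\<Sum>i<n. cmod (es ! i - c))"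
    by (simp add: sum_list_sum_nth len atLeast0LessThan)
  also have "\<dots> \<le> (\<Sum>i<n. \<Sum>k<n. cmod (U $$ (k, i)) * cmod (?MU $$ (k, i)))"
    by (intro sum_mono) (auto simp: shifted norm_mult intro!: sum_norm_le)
  \<comment> \<open>The absolute values around the moduli only match the shape of
    \<open>L2_set_mult_ineq\<close>.\<close>
  also have "\<dots> = (\<Sum>k<n. \<Sum>i<n. \<bar>cmod (U $$ (k, i))\<bar> * \<bar>cmod (?MU $$ (k, i))\<bar>)"
    by (subst sum.swap) simp
  also have "\<dots> \<le> (\<Sum>k<n. L2_set (\<lambda>i. cmod (U $$ (k, i))) {..<n}
      * L2_set (\<lambda>i. cmod (?MU $$ (k, i))) {..<n})"
    by (intro sum_mono L2_set_mult_ineq)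
  also have "\<dots> = (\<Sum>k<n. L2_set (\<lambda>j. cmod (M $$ (k, j))) {..<n})"
    by (simp add: U_row MU_row)
  also have "\<dots> = (\<Sum>k<n. L2_set (\<lambda>j. cmod (A $$ (k, j) - (if k = j then c else 0))) {..<n})"
    using A by (intro sum.cong refl L2_set_cong) (auto simp: M_def)
  finally show ?thesis .
qed

section \<open>Passage from complex to real spectra\<close>

lemma sum_list_eq_sum_count:
  fixes f :: "'a \<Rightarrow> real"
  assumes "set xs \<subseteq> X" "finite X"
  shows "(\<Sum>x\<leftarrow>xs. f x) = (\<Sum>x\<in>X. real (count_list xs x) * f x)"
  using assms(1)
proof (induction xs)
  case (Cons a xs)
  have "(\<Sum>x\<in>X. real (count_list (a # xs) x) * f x)
      = (\<Sum>x\<in>X. real (count_list xs x) * f x + (if x = a then f x else 0))"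
    by (intro sum.cong) (auto simp: algebra_simps)
  then show ?case using Cons assms(2) by (simp add: sum.distrib)
qed simp

text \<open>The embedding of the reals preserves root orders, and over the complex numbers the order
  of a product of linear factors is the number of factors vanishing at the point.\<close>

lemma order_char_poly_of_real:
  fixes A :: "real mat"
  assumes A: "A \<in> carrier_mat n n"
    and cp: "char_poly (map_mat complex_of_real A) = (\<Prod>e\<leftarrow>es. [:- e, 1:])"
  shows "Polynomial.order \<nu> (char_poly A) = count_list es (complex_of_real \<nu>)"
proof -
  interpret h: map_poly_inj_idom_divide_hom complex_of_real ..
  have "Polynomial.order \<nu> (char_poly A)
      = Polynomial.order (complex_of_real \<nu>) (char_poly (map_mat complex_of_real A))"
    by (simp add: of_real_hom.char_poly_hom[OF A] h.order_hom)
  also have "\<dots> = sum_list (map (Polynomial.order (complex_of_real \<nu>)) (map (\<lambda>e. [:- e, 1:]) es))"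
    unfolding cp by (rule order_prod_list) auto
  also have "\<dots> = count_list es (complex_of_real \<nu>)"
    by (induction es) (auto simp: order_linear')
  finally show ?thesis .
qed

text \<open>The complex bound applies because the real eigenvalues occur in the complex list with
  the same multiplicities, and any non-real eigenvalue could only enlarge the sum.\<close>

lemma spectral_deviation_le_sum_row_norms:
  assumes A: "A \<in> carrier_mat n n"
  shows "spectral_deviation A c
    \<le> (\<Sum>i<n. sqrt ((A $$ (i, i) - c)\<^sup>2 + (\<Sum>k\<in>{..<n} - {i}. (A $$ (i, k))\<^sup>2)))"
proof -
  let ?A = "map_mat complex_of_real A"
  have Ac: "?A \<in> carrier_mat n n" using A by auto
  obtain es where cp: "char_poly ?A = (\<Prod>e\<leftarrow>es. [:- e, 1:])"
    using char_poly_factorized[OF Ac] by blast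
  let ?f = "\<lambda>e. real (count_list es e) * cmod (e - complex_of_real c)"
  have fin: "finite (spectrum A)" using card_finite_spectrum[OF A] by simp
  have "spectral_deviation A c = (\<Sum>\<nu>\<in>spectrum A. ?f (complex_of_real \<nu>))"
    unfolding spectral_deviation_def order_char_poly_of_real[OF A cp]
    by (simp flip: of_real_diff)
  also have "\<dots> = sum ?f (complex_of_real ` spectrum A)"
    by (simp add: sum.reindex inj_on_def)
  \<comment> \<open>The union contains both index sets outright; a point outside \<open>es\<close>
    has count 0 and contributes nothing.\<close>
  also have "\<dots> \<le> sum ?f (set es \<union> complex_of_real ` spectrum A)"
    using fin by (intro sum_mono2) auto
  also have "\<dots> = (\<Sum>e\<leftarrow>es. cmod (e - complex_of_real c))"
    using fin by (intro sum_list_eq_sum_count[symmetric]) auto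
  also have "\<dots> \<le> (\<Sum>k<n. L2_set (\<lambda>j. cmod (?A $$ (k, j) - (if k = j then complex_of_real c else 0))) {..<n})"
    by (rule sum_eigenvalues_le_sum_row_norms[OF Ac cp])
  also have "\<dots> = (\<Sum>i<n. sqrt ((A $$ (i, i) - c)\<^sup>2 + (\<Sum>k\<in>{..<n} - {i}. (A $$ (i, k))\<^sup>2)))"
  proof (intro sum.cong refl)
    fix i assume i: "i \<in> {..<n}"
    have "(\<Sum>j<n. (cmod (?A $$ (i, j) - (if i = j then complex_of_real c else 0)))\<^sup>2)
      = (\<Sum>j<n. (A $$ (i, j) - (if i = j then c else 0))\<^sup>2)"
      using i A by (intro sum.cong) (auto simp flip: of_real_diff)
    also have "\<dots> = (A $$ (i, i) - c)\<^sup>2 + (\<Sum>k\<in>{..<n} - {i}. (A $$ (i, k))\<^sup>2)"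
      using i by (subst sum.remove[of _ i]) (auto intro!: sum.cong)
    finally show "L2_set (\<lambda>j. cmod (?A $$ (i, j) - (if i = j then complex_of_real c else 0))) {..<n}
      = sqrt ((A $$ (i, i) - c)\<^sup>2 + (\<Sum>k\<in>{..<n} - {i}. (A $$ (i, k))\<^sup>2))"
      by (simp add: L2_set_def)
  qed
  finally show ?thesis .
qed

section \<open>Degree counts in a graph\<close>

lemma nbhd_sym:
  assumes "pair_graph G" shows "y \<in> nbhd G x \<longleftrightarrow> x \<in> nbhd G y"
proof -
  interpret pair_graph G by fact
  show ?thesis using pair_sym_arcs by (auto simp: nbhd_def symmetric_def sym_def)
qed

lemma nbhd_subset:
  assumes "pair_graph G" shows "nbhd G x \<subseteq> pverts G"
proof -
  interpret pair_graph G by fact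
  show ?thesis by (auto simp: nbhd_def dest: in_arcsD2)
qed

lemma finite_nbhd:
  assumes "pair_graph G" shows "finite (nbhd G x)"
  using nbhd_subset[OF assms] assms finite_subset pair_fin_digraph.pair_finite_verts
  by (metis pair_graph.axioms(1) pair_digraph.axioms(1))

text \<open>Both sides count the walks of length two from \<open>u\<close>, by endpoint
  \<open>x\<close> on the left and by midpoint \<open>y\<close> on the right. The returning walks,
  with \<open>x = u\<close>, are included.\<close>

lemma sum_common_nbhd:
  assumes G: "pair_graph G"
  shows "(\<Sum>x\<in>pverts G. card (nbhd G u \<inter> nbhd G x)) = (\<Sum>y\<in>nbhd G u. deg G y)"
proof -
  interpret pair_graph G by fact
  note fin = finite_nbhd[OF G] pair_finite_verts
  have "(\<Sum>x\<in>pverts G. card (nbhd G u \<inter> nbhd G x))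
      = (\<Sum>x\<in>pverts G. \<Sum>y\<in>nbhd G u. if y \<in> nbhd G x then 1 else 0)"
    using fin by (simp add: sum.If_cases)
  also have "\<dots> = (\<Sum>y\<in>nbhd G u. \<Sum>x\<in>pverts G. if x \<in> nbhd G y then 1 else 0)"
    by (subst sum.swap) (simp add: nbhd_sym[OF G])
  also have "\<dots> = (\<Sum>y\<in>nbhd G u. deg G y)"
    using fin nbhd_subset[OF G] by (simp add: sum.If_cases deg_def Int_absorb1)
  finally show ?thesis .
qed

text \<open>After exchanging the sums, \<open>deg G y\<close> is counted once for every neighbour of
  \<open>y\<close>, which gives its square.\<close>

lemma sum_nbhd_deg:
  assumes G: "pair_graph G"
  shows "(\<Sum>x\<in>pverts G. \<Sum>y\<in>nbhd G x. deg G y) = zagreb1 G"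
proof -
  interpret pair_graph G by fact
  note fin = finite_nbhd[OF G] pair_finite_verts
  have N: "nbhd G x = {y \<in> pverts G. y \<in> nbhd G x}" for x
    using nbhd_subset[OF G] by auto
  have "(\<Sum>x\<in>pverts G. \<Sum>y\<in>nbhd G x. deg G y)
      = (\<Sum>x\<in>pverts G. \<Sum>y\<in>{y \<in> pverts G. y \<in> nbhd G x}. deg G y)"
    using N by simp
  also have "\<dots> = (\<Sum>y\<in>pverts G. \<Sum>x\<in>{x \<in> pverts G. y \<in> nbhd G x}. deg G y)"
    using fin by (intro sum.swap_restrict)
  also have "\<dots> = (\<Sum>y\<in>pverts G. \<Sum>x\<in>nbhd G y. deg G y)"
    by (intro sum.cong refl) (use N nbhd_sym[OF G] in blast)
  also have "\<dots> = zagreb1 G"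
    by (simp add: zagreb1_def power2_eq_square flip: deg_def)
  finally show ?thesis .
qed

text \<open>Arcs are counted by their tail and by their underlying edge; each edge carries exactly
  two arcs.\<close>

lemma handshake:
  assumes G: "pair_graph G"
  shows "(\<Sum>x\<in>pverts G. deg G x) = 2 * card (edges G)"
proof -
  interpret pair_graph G by fact
  let ?f = "\<lambda>(u, w). {u, w}"
  have img: "?f ` parcs G = edges G" by (auto simp: edges_def)
  have "parcs G = Sigma (pverts G) (nbhd G)"
    by (auto simp: nbhd_def dest: in_arcsD1)
  then have "(\<Sum>x\<in>pverts G. deg G x) = card (parcs G)"
    using pair_finite_verts finite_nbhd[OF G] by (simp add: deg_def)
  also have "\<dots> = (\<Sum>e\<in>edges G. card {a \<in> parcs G. ?f a = e})"
    using sum.image_gen[OF pair_finite_arcs, of "\<lambda>_. 1::nat" ?f] unfolding img by simp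
  also have "\<dots> = (\<Sum>e\<in>edges G. 2)"
  proof (intro sum.cong refl)
    fix e assume "e \<in> edges G"
    then obtain u w where uw: "(u, w) \<in> parcs G" "e = {u, w}" by (auto simp: edges_def)
    then have "(w, u) \<in> parcs G"
      using nbhd_sym[OF G, of u w] by (simp add: nbhd_def)
    then have "{a \<in> parcs G. ?f a = e} = {(u, w), (w, u)}"
      using uw(1) unfolding uw(2) by (force simp: doubleton_eq_iff)
    \<comment> \<open>Without loops the two opposite arcs are distinct, so the fibre has two
      elements.\<close>
    moreover have "u \<noteq> w" using no_loops'[OF uw(1)] .
    ultimately show "card {a \<in> parcs G. ?f a = e} = 2" by simp
  qed
  finally show ?thesis by simp
qed

section \<open>The common neighbourhood matrices\<close>

text \<open>The row sum of \<open>CN\<close> omits the diagonal index, so it falls short of the full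
  count of walks of length two by the \<open>deg G (v i)\<close> walks that return to
  \<open>v i\<close>.\<close>

lemma CNRS_diag:
  assumes G: "pair_graph G" and v: "labelling G v" and i: "i < order_of G"
  shows "CNRS G v $$ (i, i) = (\<Sum>y\<in>nbhd G (v i). real (deg G y)) - real (deg G (v i))"
proof -
  have bij: "bij_betw v {..<order_of G} (pverts G)"
    using v by (simp add: labelling_def)
  have "CNRS G v $$ (i, i) = (\<Sum>j<order_of G. CN G v $$ (i, j))"
    using i by (simp add: CNRS_def mat_diag_def)
  also have "\<dots> = (\<Sum>j\<in>{..<order_of G} - {i}. real (card (nbhd G (v i) \<inter> nbhd G (v j))))"
    using i by (subst sum.remove[of _ i]) (auto simp: CN_def intro!: sum.cong)
  also have "\<dots> = (\<Sum>j<order_of G. real (card (nbhd G (v i) \<inter> nbhd G (v j)))) - real (deg G (v i))"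
    using i by (subst (2) sum.remove[of _ i]) (auto simp: deg_def)
  also have "(\<Sum>j<order_of G. real (card (nbhd G (v i) \<inter> nbhd G (v j))))
      = (\<Sum>x\<in>pverts G. real (card (nbhd G (v i) \<inter> nbhd G x)))"
    by (rule sum.reindex_bij_betw[OF bij])
  also have "\<dots> = (\<Sum>y\<in>nbhd G (v i). real (deg G y))"
    using sum_common_nbhd[OF G, of "v i"] by (simp flip: of_nat_sum)
  finally show ?thesis .
qed

lemma tr_CNRS:
  assumes G: "pair_graph G" and v: "labelling G v"
  shows "tr (CNRS G v) = real (zagreb1 G) - 2 * real (card (edges G))"
proof -
  have bij: "bij_betw v {..<order_of G} (pverts G)"
    using v by (simp add: labelling_def)
  have "tr (CNRS G v) = (\<Sum>i<order_of G. (\<Sum>y\<in>nbhd G (v i). real (deg G y)) - real (deg G (v i)))"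
    unfolding tr_def by (intro sum.cong) (auto simp: CNRS_diag[OF G v], simp add: CNRS_def mat_diag_def)
  also have "\<dots> = (\<Sum>x\<in>pverts G. (\<Sum>y\<in>nbhd G x. real (deg G y)) - real (deg G x))"
    by (rule sum.reindex_bij_betw[OF bij])
  also have "\<dots> = real (zagreb1 G) - real (\<Sum>x\<in>pverts G. deg G x)"
    by (simp add: sum_subtractf flip: sum_nbhd_deg[OF G])
  finally show ?thesis using handshake[OF G] by simp
qed

text \<open>Treats both Laplacians at once: \<open>CN\<close> vanishes on the diagonal and
  \<open>CNRS\<close> off it, so the sign of \<open>CN\<close> affects only off-diagonal entries,
  and these are squared.\<close>

lemma spectral_deviation_CN_le:
  assumes G: "pair_graph G" and v: "labelling G v"
    and K: "K = CNRS G v - CN G v \<or> K = CNRS G v + CN G v"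
  shows "spectral_deviation K c \<le> (\<Sum>i<order_of G. sqrt ((CNRS G v $$ (i, i) - c)\<^sup>2
        + (\<Sum>k\<in>{..<order_of G} - {i}. (real (card (nbhd G (v i) \<inter> nbhd G (v k))))\<^sup>2)))"
    (is "_ \<le> ?B")
proof -
  have Kc: "K \<in> carrier_mat (order_of G) (order_of G)"
    using K by (auto simp: CNRS_def CN_def)
  have "spectral_deviation K c \<le> (\<Sum>i<order_of G. sqrt ((K $$ (i, i) - c)\<^sup>2
      + (\<Sum>k\<in>{..<order_of G} - {i}. (K $$ (i, k))\<^sup>2)))"
    by (rule spectral_deviation_le_sum_row_norms[OF Kc])
  also have "\<dots> = ?B"
    using K by (intro sum.cong refl arg_cong[of _ _ sqrt] arg_cong2[of _ _ _ _ "(+)"])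
      (auto simp: CNRS_def CN_def mat_diag_def)
  finally show ?thesis .
qed

theorem theorem5p8:
  fixes G :: "'a pair_pre_digraph" and v :: "nat \<Rightarrow> 'a" and p :: nat and B :: real
  assumes "pair_graph G"
    and "p = order_of G"
    and "labelling G v"
    and "\<And>i j. i \<le> j \<Longrightarrow> j < p \<Longrightarrow> CNRS G v $$ (j, j) \<le> CNRS G v $$ (i, i)"
  defines "B \<equiv> (\<Sum>i<p. sqrt
      ((CNRS G v $$ (i, i) - (real (zagreb1 G) - 2 * real (card (edges G))) / real p)\<^sup>2
        + (\<Sum>k\<in>{..<p} - {i}. (real (card (nbhd G (v i) \<inter> nbhd G (v k))))\<^sup>2)))"
  shows "(\<forall>i<p. CNRS G v $$ (i, i) = real (deg G (v i)) * (avg_nbr_deg G (v i) - 1))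
    \<and> LE_CN G v \<le> B \<and> LE_CN_plus G v \<le> B"
proof (intro conjI allI impI)
  note G = assms(1) and v = assms(3)
  fix i assume "i < p"
  then have "CNRS G v $$ (i, i) = (\<Sum>y\<in>nbhd G (v i). real (deg G y)) - real (deg G (v i))"
    using CNRS_diag[OF G v] assms(2) by simp
  \<comment> \<open>At an isolated vertex both sides are 0, since the default average degree is
    multiplied by degree 0.\<close>
  also have "\<dots> = real (deg G (v i)) * (avg_nbr_deg G (v i) - 1)"
    using finite_nbhd[OF G, of "v i"]
    by (cases "nbhd G (v i) = {}") (simp_all add: avg_nbr_deg_def deg_def card_eq_0_iff right_diff_distrib)
  finally show "CNRS G v $$ (i, i) = real (deg G (v i)) * (avg_nbr_deg G (v i) - 1)" .
next
  note G = assms(1) and v = assms(3)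
  \<comment> \<open>By \<open>tr_CNRS\<close> the centre of both energies is the constant subtracted
    in \<open>B\<close>, so each claim is the preceding bound at that value of
    \<open>c\<close>.\<close>
  show "LE_CN G v \<le> B" "LE_CN_plus G v \<le> B"
    unfolding LE_CN_def LE_CN_plus_def CNL_def CNSL_def tr_CNRS[OF G v] B_def assms(2)
    by (rule spectral_deviation_CN_le[OF G v]; simp)+
qed

end
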